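(* Let $N\ge2$, let $\xi_1,\ldots,\xi_N$ be distinct nodes, let $W_N=\operatorname{diag}(w_1,\ldots,w_N)$ with all $w_i>0$, and let $\psi_0,\ldots,\psi_{N-1}$ be real-valued functions on $\{\xi_1,\ldots,\xi_N\}$ whose sampling matrix $\Psi_N=[\psi_k(\xi_i)]_{i=1,\ldots,N;\,k=0,\ldots,N-1}$ satisfies $$\Psi_N^\top W_N\Psi_N=\operatorname{diag}(\nu_0,\ldots,\nu_{N-1}),\quad \nu_k>0.$$ Let $\omega$ be a nonnegative measurable weight on $(-1,1)$, let $s_1,\ldots,s_N\subset(-1,1)$ be measurable cells with $0<\int_{s_i}\omega(x)\,dx<\infty$ for all $i$, and let $P_0,\ldots,P_{N-1}$ be real-valued functions that are integrable with respect to $\omega$ on each cell. Define $M_N\in\mathbb R^{N\times N}$ by $[M_N]_{i,k+1}=\int_{s_i}P_k(x)\omega(x)\,dx$, $i=1,\ldots,N$, $k=0,\ldots,N-1$. Assume that there exist nonzero real numbers $\gamma_0,\ldots,\gamma_{N-1}$ such that $$\int_{s_i}P_k(x)\omega(x)\,dx=\gamma_k\psi_k(\xi_i),\quad i=1,\ldots,N,\ k=0,\ldots,N-1.$$ Then $$M_N^\top W_NM_N=\operatorname{diag}\left(\nu_0\gamma_0^2,\ldots,\nu_{N-1}\gamma_{N-1}^2\right).$$ In particular, $M_N$ is nonsingular. *)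

theory Defs
  imports "HOL-Analysis.Set_Integral" "HOL-Analysis.Lebesgue_Measure"
    "Jordan_Normal_Form.Matrix"
begin

text \<open>Nodes, weights and cells are numbered from 1 to N, while matrix rows are numbered
  from 0; hence the shift by Suc in the row index.\<close>

definition sampling_matrix :: "nat \<Rightarrow> (nat \<Rightarrow> 'a \<Rightarrow> real) \<Rightarrow> (nat \<Rightarrow> 'a) \<Rightarrow> real mat" where
  "sampling_matrix N \<psi> \<xi> = mat N N (\<lambda>(i, k). \<psi> k (\<xi> (Suc i)))"

definition weight_matrix :: "nat \<Rightarrow> (nat \<Rightarrow> real) \<Rightarrow> real mat" where
  "weight_matrix N w = mat_diag N (\<lambda>i. w (Suc i))"

definition cell_moment_matrix ::
  "nat \<Rightarrow> (real \<Rightarrow> real) \<Rightarrow> (nat \<Rightarrow> real set) \<Rightarrow> (nat \<Rightarrow> real \<Rightarrow> real) \<Rightarrow> real mat" where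
  "cell_moment_matrix N \<omega> s P =
     mat N N (\<lambda>(i, k). set_lebesgue_integral lebesgue (s (Suc i)) (\<lambda>x. P k x * \<omega> x))"

end

theory Submission
  imports Defs "Jordan_Normal_Form.Determinant"
begin

text \<open>
  The moment identity says that every column of the cell moment matrix is a multiple of the
  corresponding column of the sampling matrix: \<open>M = \<Psi> \<Gamma>\<close> with
  \<open>\<Gamma> = diag (\<gamma>\<^sub>0, \<dots>, \<gamma>\<^sub>N\<^sub>-\<^sub>1)\<close>. Therefore
  \<open>M\<^sup>T W M = \<Gamma> (\<Psi>\<^sup>T W \<Psi>) \<Gamma> = \<Gamma> diag(\<nu>) \<Gamma>\<close>, a product of diagonal matrices
  (lemma \<open>column_scaling_diagonal_gram\<close>). Its diagonal entries \<open>\<nu>\<^sub>k \<gamma>\<^sub>k\<^sup>2\<close> do not vanish, so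
  rescaling the rows of \<open>M\<^sup>T W\<close> produces a left inverse of \<open>M\<close>
  (lemma \<open>invertible_mat_if_left_mult_diagonal\<close>).
\<close>

lemma transpose_mat_diag: "transpose_mat (mat_diag n f) = mat_diag n f"
  by (rule eq_matI) (auto simp: mat_diag_def)

lemma column_scaling_diagonal_gram:
  fixes A S :: "'a :: comm_semiring_1 mat"
  assumes A: "A \<in> carrier_mat m n" and S: "S \<in> carrier_mat m m"
    and gram: "transpose_mat A * S * A = mat_diag n d"
  shows "transpose_mat (A * mat_diag n g) * S * (A * mat_diag n g)
           = mat_diag n (\<lambda>k. d k * (g k)\<^sup>2)"
proof -
  let ?D = "mat_diag n g"
  have D: "?D \<in> carrier_mat n n" by simp
  have At: "transpose_mat A \<in> carrier_mat n m" using A by simp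
  have AtS: "transpose_mat A * S \<in> carrier_mat n m"
    using mult_carrier_mat[OF At S] .
  have "transpose_mat (A * ?D) * S * (A * ?D) = ?D * transpose_mat A * S * (A * ?D)"
    by (simp add: transpose_mult[OF A D] transpose_mat_diag)
  also have "\<dots> = ?D * (transpose_mat A * S) * (A * ?D)"
    by (simp add: assoc_mult_mat[OF D At S])
  also have "\<dots> = ?D * (transpose_mat A * S * (A * ?D))"
    by (rule assoc_mult_mat[OF D AtS mult_carrier_mat[OF A D]])
  also have "transpose_mat A * S * (A * ?D) = transpose_mat A * S * A * ?D"
    by (simp add: assoc_mult_mat[OF AtS A D])
  also have "?D * (transpose_mat A * S * A * ?D) = mat_diag n (\<lambda>k. d k * (g k)\<^sup>2)"
    by (simp add: gram power2_eq_square ac_simps)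
  finally show ?thesis .
qed

text \<open>
  Scaling row \<open>k\<close> of \<open>B\<close> by \<open>1 / d k\<close> turns \<open>B\<close> into a left inverse of the square matrix
  \<open>A\<close>, and over a field a one-sided inverse of a square matrix is two-sided.
\<close>

lemma invertible_mat_if_left_mult_diagonal:
  fixes A B :: "'a :: field mat"
  assumes A: "A \<in> carrier_mat n n" and B: "B \<in> carrier_mat n n"
    and BA: "B * A = mat_diag n d" and d: "\<forall>k<n. d k \<noteq> 0"
  shows "invertible_mat A"
proof -
  let ?C = "mat_diag n (\<lambda>k. inverse (d k)) * B"
  have C: "?C \<in> carrier_mat n n"
    using mult_carrier_mat[OF mat_diag_dim B] .
  have "?C * A = mat_diag n (\<lambda>k. inverse (d k)) * (B * A)"
    by (rule assoc_mult_mat[OF mat_diag_dim B A])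
  also have "\<dots> = 1\<^sub>m n"
    unfolding BA mat_diag_diag using d by (intro eq_matI) (auto simp: mat_diag_def)
  finally have CA: "?C * A = 1\<^sub>m n" .
  have "A * ?C = 1\<^sub>m n"
    by (rule mat_mult_left_right_inverse[OF C A CA])
  with CA A C have "inverts_mat A ?C" "inverts_mat ?C A"
    by (simp_all only: inverts_mat_def carrier_matD)
  with A show ?thesis
    unfolding invertible_mat_def square_mat.simps by blast
qed

lemma cell_moment_matrix_eq_scaled_sampling_matrix:
  assumes "\<forall>i\<in>{1..N}. \<forall>k<N.
    set_lebesgue_integral lebesgue (s i) (\<lambda>x. P k x * \<omega> x) = \<gamma> k * \<psi> k (\<xi> i)"
  shows "cell_moment_matrix N \<omega> s P = sampling_matrix N \<psi> \<xi> * mat_diag N \<gamma>"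
proof -
  have "sampling_matrix N \<psi> \<xi> * mat_diag N \<gamma>
      = mat N N (\<lambda>(i, k). sampling_matrix N \<psi> \<xi> $$ (i, k) * \<gamma> k)"
    by (rule mat_diag_mult_right) (simp add: sampling_matrix_def)
  also have "\<dots> = cell_moment_matrix N \<omega> s P"
    unfolding cell_moment_matrix_def
  proof (rule cong_mat)
    fix i k assume "i < N" "k < N"
    moreover from this have "Suc i \<in> {1..N}" by simp
    ultimately show "(case (i, k) of (i, k) \<Rightarrow> sampling_matrix N \<psi> \<xi> $$ (i, k) * \<gamma> k)
        = (case (i, k) of (i, k) \<Rightarrow>
             set_lebesgue_integral lebesgue (s (Suc i)) (\<lambda>x. P k x * \<omega> x))"
      using assms by (simp add: sampling_matrix_def mult.commute)
  qed simp_all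
  finally show ?thesis by (rule sym)
qed

theorem proposition3:
  fixes N :: nat
    and \<xi> :: "nat \<Rightarrow> 'a"
    and w \<nu> \<gamma> :: "nat \<Rightarrow> real"
    and \<psi> :: "nat \<Rightarrow> 'a \<Rightarrow> real"
    and \<omega> :: "real \<Rightarrow> real"
    and s :: "nat \<Rightarrow> real set"
    and P :: "nat \<Rightarrow> real \<Rightarrow> real"
  assumes "N \<ge> 2"
    and "inj_on \<xi> {1..N}"
    and "\<forall>i\<in>{1..N}. w i > 0"
    and "\<forall>k<N. \<nu> k > 0"
    and "transpose_mat (sampling_matrix N \<psi> \<xi>) * weight_matrix N w * sampling_matrix N \<psi> \<xi>
           = mat_diag N \<nu>"
    and "\<omega> \<in> borel_measurable (lebesgue_on {-1<..<1})"
    and "\<forall>x\<in>{-1<..<1}. \<omega> x \<ge> 0"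
    and "\<forall>i\<in>{1..N}. s i \<in> sets lebesgue \<and> s i \<subseteq> {-1<..<1}"
    and "\<forall>i\<in>{1..N}. 0 < (\<integral>\<^sup>+x\<in>s i. ennreal (\<omega> x) \<partial>lebesgue)
           \<and> (\<integral>\<^sup>+x\<in>s i. ennreal (\<omega> x) \<partial>lebesgue) < \<infinity>"
    and "\<forall>i\<in>{1..N}. \<forall>k<N. set_integrable lebesgue (s i) (\<lambda>x. P k x * \<omega> x)"
    and "\<forall>k<N. \<gamma> k \<noteq> 0"
    and "\<forall>i\<in>{1..N}. \<forall>k<N.
           set_lebesgue_integral lebesgue (s i) (\<lambda>x. P k x * \<omega> x) = \<gamma> k * \<psi> k (\<xi> i)"
  shows "transpose_mat (cell_moment_matrix N \<omega> s P) * weight_matrix N w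
             * cell_moment_matrix N \<omega> s P
           = mat_diag N (\<lambda>k. \<nu> k * (\<gamma> k)\<^sup>2)
         \<and> invertible_mat (cell_moment_matrix N \<omega> s P)"
proof -
  let ?M = "cell_moment_matrix N \<omega> s P"
  let ?\<Psi> = "sampling_matrix N \<psi> \<xi>"
  let ?W = "weight_matrix N w"
  have \<Psi>: "?\<Psi> \<in> carrier_mat N N" by (simp add: sampling_matrix_def)
  have W: "?W \<in> carrier_mat N N" by (simp add: weight_matrix_def)
  have M: "?M \<in> carrier_mat N N" by (simp add: cell_moment_matrix_def)
  have scaled: "?M = ?\<Psi> * mat_diag N \<gamma>"
    by (rule cell_moment_matrix_eq_scaled_sampling_matrix) (rule assms(12))
  have gram: "transpose_mat ?M * ?W * ?M = mat_diag N (\<lambda>k. \<nu> k * (\<gamma> k)\<^sup>2)"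
    unfolding scaled
    by (rule column_scaling_diagonal_gram[OF \<Psi> W assms(5)])
  have "\<forall>k<N. \<nu> k * (\<gamma> k)\<^sup>2 \<noteq> 0"
    using assms(4,11) by (metis less_irrefl mult_eq_0_iff power_not_zero)
  moreover have "transpose_mat ?M * ?W \<in> carrier_mat N N"
    using M W by (intro mult_carrier_mat) (simp_all only: transpose_carrier_mat)
  ultimately have "invertible_mat ?M"
    by (intro invertible_mat_if_left_mult_diagonal[OF M _ gram])
  with gram show ?thesis by blast
qed

end
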